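(* Let $C$ be an arithmetic circuit of size $t$ and formal degree $d$ in which all multiplication gates are binary. There is an arithmetic branching program $G$ computing the same polynomial as $C$, of size at most $t^{\log_2(2d)}+1$ and depth at most $3d-1$, whose edges are labelled by inputs of $C$ or by constants. Moreover, if all the addition gates of $C$ are ordinary additions or subtractions, then these constants are integers of absolute value at most $2^t$.
   Context: An arithmetic circuit has input gates labelled by variables or field constants (each of fan-out at most 1), multiplication gates, and addition gates, which may be weighted (computing $\sum a_ix_i$ from inputs $x_i$ with weights $a_i$); ordinary addition and subtraction gates are binary with weights $(1,1)$ and $(1,-1)$. Size is the number of gates including inputs. Formal degree: 1 for inputs, maximum of inputs' formal degrees for addition gates, sum for multiplication gates; the circuit's formal degree is that of its output. An arithmetic branching program is an edge-weighted directed acyclic graph with distinguished vertices $s,t$, computing the sum over all $s$–$t$ paths of the product of edge weights; its size is its number of vertices and its depth the maximal number of edges of an $s$–$t$ path. *)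

theory Defs
  imports Complex_Main "HOL-Library.Poly_Mapping" "Graph_Theory.Pair_Digraph"
begin

text \<open>
  Multivariate polynomials over \<^typ>\<open>'k\<close> in variables from \<^typ>\<open>'v\<close>: finitely supported
  coefficient functions on the monomials \<^typ>\<open>'v \<Rightarrow>\<^sub>0 nat\<close>, with the convolution product.
\<close>

type_synonym ('v, 'k) mpoly = "('v \<Rightarrow>\<^sub>0 nat) \<Rightarrow>\<^sub>0 'k"

definition poly_const :: "'k::zero \<Rightarrow> ('v, 'k) mpoly" where
  "poly_const c = Poly_Mapping.single 0 c"

definition poly_var :: "'v \<Rightarrow> ('v, 'k::zero_neq_one) mpoly" where
  "poly_var x = Poly_Mapping.single (Poly_Mapping.single x 1) 1"


subsection \<open>Arithmetic circuits\<close>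

datatype ('v, 'k) input = Var 'v | Const 'k

text \<open>
  A circuit is a directed acyclic graph whose gates are listed in a topological order. The
  arguments of a gate are given by their positions in this list, repetitions being
  allowed; in \<open>Add\<close> every argument comes with its weight.
\<close>

datatype ('v, 'k) gate =
    Input "('v, 'k) input"
  | Mult "nat list"
  | Add "('k \<times> nat) list"

record ('v, 'k) circuit =
  gates :: "('v, 'k) gate list"
  out_gate :: nat

fun gate_args :: "('v, 'k) gate \<Rightarrow> nat list" where
  "gate_args (Input x) = []"
| "gate_args (Mult js) = js"
| "gate_args (Add ajs) = map snd ajs"

definition is_input :: "('v, 'k) gate \<Rightarrow> bool" where
  "is_input g \<longleftrightarrow> (\<exists>x. g = Input x)"

text \<open>The number of wires leaving gate \<open>i\<close>, counted with multiplicity.\<close>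

definition fan_out :: "('v, 'k) circuit \<Rightarrow> nat \<Rightarrow> nat" where
  "fan_out C i = count_list (concat (map gate_args (gates C))) i"

definition wf_circuit :: "('v, 'k) circuit \<Rightarrow> bool" where
  "wf_circuit C \<longleftrightarrow>
     out_gate C < length (gates C) \<and>
     (\<forall>i < length (gates C).
        (\<forall>j \<in> set (gate_args (gates C ! i)). j < i) \<and>
        (if is_input (gates C ! i) then fan_out C i \<le> 1 else gate_args (gates C ! i) \<noteq> []))"

definition circuit_size :: "('v, 'k) circuit \<Rightarrow> nat" where
  "circuit_size C = length (gates C)"

fun input_poly :: "('v, 'k::field) input \<Rightarrow> ('v, 'k) mpoly" where
  "input_poly (Var x) = poly_var x"
| "input_poly (Const c) = poly_const c"

text \<open>
  The tests \<open>j < i\<close> below only serve termination: they are always true in a well-formed circuit.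
\<close>

fun gate_poly :: "('v, 'k::field) gate list \<Rightarrow> nat \<Rightarrow> ('v, 'k) mpoly" where
  "gate_poly gs i = (case gs ! i of
       Input x \<Rightarrow> input_poly x
     | Mult js \<Rightarrow> (\<Prod>j\<leftarrow>js. if j < i then gate_poly gs j else 0)
     | Add ajs \<Rightarrow> (\<Sum>(a, j)\<leftarrow>ajs. if j < i then poly_const a * gate_poly gs j else 0))"

fun gate_degree :: "('v, 'k) gate list \<Rightarrow> nat \<Rightarrow> nat" where
  "gate_degree gs i = (case gs ! i of
       Input x \<Rightarrow> 1
     | Mult js \<Rightarrow> (\<Sum>j\<leftarrow>js. if j < i then gate_degree gs j else 0)
     | Add ajs \<Rightarrow> Max (set (map (\<lambda>(a, j). if j < i then gate_degree gs j else 0) ajs)))"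

declare gate_poly.simps [simp del] gate_degree.simps [simp del]

definition circuit_poly :: "('v, 'k::field) circuit \<Rightarrow> ('v, 'k) mpoly" where
  "circuit_poly C = gate_poly (gates C) (out_gate C)"

definition formal_degree :: "('v, 'k) circuit \<Rightarrow> nat" where
  "formal_degree C = gate_degree (gates C) (out_gate C)"

definition circuit_inputs :: "('v, 'k) circuit \<Rightarrow> ('v, 'k) input set" where
  "circuit_inputs C = {x. Input x \<in> set (gates C)}"

definition binary_mults :: "('v, 'k) circuit \<Rightarrow> bool" where
  "binary_mults C \<longleftrightarrow> (\<forall>js. Mult js \<in> set (gates C) \<longrightarrow> length js = 2)"

definition ordinary_adds :: "('v, 'k::field) circuit \<Rightarrow> bool" where
  "ordinary_adds C \<longleftrightarrow>
     (\<forall>ajs. Add ajs \<in> set (gates C) \<longrightarrow> map fst ajs = [1, 1] \<or> map fst ajs = [1, -1])"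


subsection \<open>Arithmetic branching programs\<close>

record ('n, 'r) abp =
  graph :: "'n pair_pre_digraph"
  weight :: "'n \<times> 'n \<Rightarrow> 'r"
  source :: 'n
  sink :: 'n

definition wf_abp :: "('n, 'r) abp \<Rightarrow> bool" where
  "wf_abp G \<longleftrightarrow>
     pair_fin_digraph (graph G) \<and> acyclic (parcs (graph G)) \<and>
     source G \<in> pverts (graph G) \<and> sink G \<in> pverts (graph G) \<and> source G \<noteq> sink G"

text \<open>Paths are represented by their lists of arcs.\<close>

definition abp_paths :: "('n, 'r) abp \<Rightarrow> ('n \<times> 'n) list set" where
  "abp_paths G = {p. pre_digraph.apath (with_proj (graph G)) (source G) p (sink G)}"

definition abp_value :: "('n, 'r::comm_ring_1) abp \<Rightarrow> 'r" where
  "abp_value G = (\<Sum>p \<in> abp_paths G. \<Prod>e\<leftarrow>p. weight G e)"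

definition abp_size :: "('n, 'r) abp \<Rightarrow> nat" where
  "abp_size G = card (pverts (graph G))"

text \<open>
  On \<^typ>\<open>nat\<close> this supremum is the maximum, or 0 if there is no path from source to sink.
\<close>

definition abp_depth :: "('n, 'r) abp \<Rightarrow> nat" where
  "abp_depth G = (SUP p \<in> abp_paths G. length p)"

end

theory Submission
  imports Defs "HOL-Library.Countable"
begin

text \<open>
  A gate is represented by a vertex such that the paths from the source to it sum up to the polynomial
  of the gate. A product of \<open>u\<close> and \<open>v\<close> with \<open>deg v \<le> deg u\<close> is obtained by attaching, behind the
  vertex of \<open>u\<close>, a fresh copy of the part of the circuit of degree at most \<open>deg v\<close>. As
  \<open>2 * deg v \<le> d\<close>, the number \<open>N d\<close> of vertices other than the source satisfies
  \<open>N d \<le> t * N (d / 2)\<close>, whence the bound on the size. Chains of additions are composed into a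
  single linear combination of inputs and products, whose coefficients at most double at every
  addition; then a path to an addition gate of degree \<open>d\<close> has at most \<open>3 * d - 1\<close> arcs and a path
  to any other gate at most \<open>3 * d - 2\<close>.
\<close>

section \<open>Path sums in levelled graphs\<close>

context pair_fin_digraph
begin

context
  fixes L :: "'a \<Rightarrow> nat"
  assumes arc_level: "\<And>u v. (u, v) \<in> parcs G \<Longrightarrow> L u < L v"
begin

lemma level_awalk_verts_ge:
  assumes "awalk u p v" "x \<in> set (pawalk_verts u p)"
  shows "L u \<le> L x"
  using assms
proof (induction p arbitrary: u)
  case (Cons e p)
  then have "L u < L (snd e)"
    using arc_level[of "fst e" "snd e"] by (auto simp: awalk_Cons_iff)
  with Cons show ?case
    by (force simp: awalk_Cons_iff)
qed simp

text \<open>Levels strictly increase along a walk, so no vertex repeats. Walks, unlike paths, can be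
  cut freely at their last arc.\<close>

lemma apath_iff_awalk_of_level: "apath u p v \<longleftrightarrow> awalk u p v"
proof
  assume "awalk u p v"
  then show "apath u p v"
  proof (induction p arbitrary: u)
    case (Cons e p)
    have "L u < L (snd e)" "awalk (snd e) p v"
      using Cons.prems arc_level[of "fst e" "snd e"] by (auto simp: awalk_Cons_iff)
    then have "u \<notin> set (pawalk_verts (snd e) p)"
      using level_awalk_verts_ge by fastforce
    with Cons show ?case
      by (auto simp: awalk_Cons_iff apath_Cons_iff)
  qed (simp add: apath_Nil_iff awalk_Nil_iff)
qed (rule awalkI_apath)

lemma level_awalk_length:
  assumes "awalk u p v"
  shows "L u + length p \<le> L v"
  using assms
proof (induction p arbitrary: u)
  case (Cons e p)
  have "L u < L (snd e)" "awalk (snd e) p v"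
    using Cons.prems arc_level[of "fst e" "snd e"] by (auto simp: awalk_Cons_iff)
  with Cons.IH[of "snd e"] show ?case by simp
qed (simp add: awalk_Nil_iff)

lemma acyclic_of_level: "acyclic (parcs G)"
proof -
  have "(u, v) \<in> (parcs G)\<^sup>+ \<Longrightarrow> L u < L v" for u v
    by (induction rule: trancl_induct) (auto dest: arc_level)
  then show ?thesis
    by (force simp: acyclic_def)
qed

lemma awalk_set_snoc:
  assumes "v \<noteq> s"
  shows "{p. awalk s p v} = (\<Union>u\<in>{u. (u, v) \<in> parcs G}. (\<lambda>p. p @ [(u, v)]) ` {p. awalk s p u})"
    (is "?l = ?r")
proof
  show "?l \<subseteq> ?r"
  proof
    fix p assume "p \<in> ?l"
    then have p: "awalk s p v" by simp
    with assms have "p \<noteq> []" by (auto simp: awalk_Nil_iff)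
    then obtain q u w where q: "p = q @ [(u, w)]"
      by (metis prod.collapse rev_exhaust)
    with p have "awalk s q u" "(u, w) \<in> parcs G" "w = v"
      by (auto simp: awalk_simps)
    with q show "p \<in> ?r" by auto
  qed
  show "?r \<subseteq> ?l"
    by (auto intro!: awalk_appendI simp: awalk_simps dest: in_arcsD2)
qed

lemma finite_arc_tails: "finite {u. (u, v) \<in> parcs G}"
  by (rule finite_subset[OF _ pair_finite_verts]) (auto dest: in_arcsD1)

text \<open>Grouping walks by their last arc shows that path sums obey the same recurrence as
  \<open>P\<close>; induction on the level identifies the two.\<close>

lemma sum_awalk_weights:
  fixes P :: "'a \<Rightarrow> 'r::comm_ring_1" and w :: "'a \<times> 'a \<Rightarrow> 'r"
  assumes source: "s \<in> pverts G" "P s = 1" "\<And>u. (u, s) \<notin> parcs G"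
    and step: "\<And>v. v \<in> pverts G \<Longrightarrow> v \<noteq> s \<Longrightarrow> P v = (\<Sum>u | (u, v) \<in> parcs G. P u * w (u, v))"
    and "v \<in> pverts G"
  shows "(\<Sum>p | awalk s p v. \<Prod>e\<leftarrow>p. w e) = P v"
  using \<open>v \<in> pverts G\<close>
proof (induction "L v" arbitrary: v rule: less_induct)
  case less
  show ?case
  proof (cases "v = s")
    case True
    have "{p. awalk s p s} = {[]}"
    proof -
      have "p = []" if "awalk s p s" for p
        using level_awalk_length[OF that] by simp
      with source(1) show ?thesis by (auto simp: awalk_Nil_iff)
    qed
    with True source(2) show ?thesis by simp
  next
    case False
    have fin: "finite {p. awalk s p u}" for u
      using apaths_finite[of s u] by (simp add: apath_iff_awalk_of_level)
    have "(\<Sum>p | awalk s p v. \<Prod>e\<leftarrow>p. w e)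
        = (\<Sum>u | (u, v) \<in> parcs G. \<Sum>p\<in>(\<lambda>p. p @ [(u, v)]) ` {p. awalk s p u}. \<Prod>e\<leftarrow>p. w e)"
      unfolding awalk_set_snoc[OF False]
      \<comment> \<open>Walks with different last arcs are different, so the union is
        disjoint.\<close>
      by (rule sum.UNION_disjoint) (auto simp: finite_arc_tails fin)
    also have "\<dots> = (\<Sum>u | (u, v) \<in> parcs G. (\<Sum>p | awalk s p u. \<Prod>e\<leftarrow>p. w e) * w (u, v))"
      by (simp add: sum.reindex inj_on_def sum_distrib_right)
    also have "\<dots> = (\<Sum>u | (u, v) \<in> parcs G. P u * w (u, v))"
    proof (intro sum.cong refl)
      fix u assume "u \<in> {u. (u, v) \<in> parcs G}"
      then have "L u < L v" "u \<in> pverts G"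
        by (auto intro: arc_level in_arcsD1)
      then show "(\<Sum>p | awalk s p u. \<Prod>e\<leftarrow>p. w e) * w (u, v) = P u * w (u, v)"
        using less.hyps by simp
    qed
    also have "\<dots> = P v" using step[OF less.prems False] ..
    finally show ?thesis .
  qed
qed

end

end

text \<open>Reduces the construction to naming vertices, arcs, a potential and a level: the
  recurrence \<open>step\<close> gives the value, the level of the sink bounds the depth.\<close>

lemma abp_of_potential:
  fixes V :: "'n::countable set" and E :: "'n rel" and w :: "'n \<times> 'n \<Rightarrow> 'r::comm_ring_1"
    and P :: "'n \<Rightarrow> 'r" and L :: "'n \<Rightarrow> nat"
  assumes V: "finite V" "E \<subseteq> V \<times> V" "s \<in> V" "z \<in> V" "s \<noteq> z"
    and level: "\<And>u v. (u, v) \<in> E \<Longrightarrow> L u < L v"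
    and source: "P s = 1" "\<And>u. (u, s) \<notin> E"
    and step: "\<And>v. v \<in> V \<Longrightarrow> v \<noteq> s \<Longrightarrow> P v = (\<Sum>u | (u, v) \<in> E. P u * w (u, v))"
  shows "\<exists>G :: (nat, 'r) abp. wf_abp G \<and> abp_value G = P z \<and> abp_size G = card V \<and>
    abp_depth G \<le> L z \<and> (\<forall>e \<in> parcs (graph G). \<exists>e' \<in> E. weight G e = w e')"
proof -
  \<comment> \<open>The required vertex type is \<open>nat\<close>, so vertices are encoded by
    \<open>to_nat\<close>; weights, potential and level are pulled back along
    \<open>from_nat\<close>.\<close>
  let ?H = "\<lparr>pverts = to_nat ` V, parcs = map_prod to_nat to_nat ` E\<rparr> :: nat pair_pre_digraph"
  define G :: "(nat, 'r) abp" where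
    "G = \<lparr>graph = ?H, weight = w \<circ> map_prod from_nat from_nat, source = to_nat s, sink = to_nat z\<rparr>"
  interpret pair_fin_digraph ?H
    using V finite_subset[OF V(2)] by unfold_locales auto
  have level': "(L \<circ> from_nat) u < (L \<circ> from_nat) v" if "(u, v) \<in> parcs ?H" for u v
    using that level by auto
  have paths: "abp_paths G = {p. awalk (to_nat s) p (to_nat z)}"
    using apath_iff_awalk_of_level[of "L \<circ> from_nat", OF level']
    by (simp add: abp_paths_def G_def)
  have "abp_value G = (P \<circ> from_nat) (to_nat z)"
    unfolding abp_value_def paths
    using V
  proof (subst sum_awalk_weights[of "L \<circ> from_nat" "to_nat s" "P \<circ> from_nat", OF level', symmetric])
    fix v assume v: "v \<in> pverts ?H" "v \<noteq> to_nat s"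
    then obtain x where x: "v = to_nat x" "x \<in> V" "x \<noteq> s" by auto
    have "{u. (u, v) \<in> parcs ?H} = to_nat ` {y. (y, x) \<in> E}"
      using x(1) by auto
    then show "(P \<circ> from_nat) v = (\<Sum>u | (u, v) \<in> parcs ?H. (P \<circ> from_nat) u * weight G (u, v))"
      using step[OF x(2,3)] x(1) by (simp add: sum.reindex G_def)
  qed (auto simp: source)
  moreover have "abp_depth G \<le> L z"
  proof -
    have "length p \<le> L z" if "p \<in> abp_paths G" for p
      using level_awalk_length[of "L \<circ> from_nat" "to_nat s" p "to_nat z", OF level'] that
      by (simp add: paths)
    then show ?thesis
      \<comment> \<open>Without any path the depth is the supremum of the empty set, which is 0 on
        \<open>nat\<close>.\<close>
      unfolding abp_depth_def by (cases "abp_paths G = {}") (simp, rule cSUP_least)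
  qed
  moreover have "wf_abp G"
    using V pair_fin_digraph_axioms acyclic_of_level[of "L \<circ> from_nat", OF level']
    by (auto simp: wf_abp_def G_def)
  moreover have "abp_size G = card V"
    by (simp add: abp_size_def G_def card_image)
  moreover have "\<forall>e \<in> parcs (graph G). \<exists>e' \<in> E. weight G e = w e'"
    by (auto simp: G_def)
  ultimately show ?thesis
    by (intro exI[of _ G]) simp
qed

section \<open>Coefficients of composed additions\<close>

lemma poly_const_0 [simp]: "poly_const 0 = 0"
  by (simp add: poly_const_def)

lemma poly_const_1 [simp]: "poly_const 1 = 1"
  by (simp add: poly_const_def)

lemma poly_const_add: "poly_const (a + b) = poly_const a + poly_const b"
  by (simp add: poly_const_def single_add)

lemma poly_const_mult: "poly_const (a * b :: 'k::field) = poly_const a * poly_const b"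
  by (simp add: poly_const_def mult_single)

text \<open>
  Composing the weights along chains of addition gates writes gate \<open>i\<close> as a linear combination
  of gates \<open>h\<close> that are not additions; this is the coefficient of \<open>h\<close>.
\<close>

fun add_coeff :: "('v, 'k::field) gate list \<Rightarrow> nat \<Rightarrow> nat \<Rightarrow> 'k" where
  "add_coeff gs i h = (case gs ! i of
       Add ajs \<Rightarrow> (\<Sum>(a, j)\<leftarrow>ajs. if j < i then a * add_coeff gs j h else 0)
     | _ \<Rightarrow> if h = i then 1 else 0)"

declare add_coeff.simps [simp del]

definition is_mult :: "('v, 'k) gate \<Rightarrow> bool" where
  "is_mult g \<longleftrightarrow> (\<exists>js. g = Mult js)"

definition is_add :: "('v, 'k) gate \<Rightarrow> bool" where
  "is_add g \<longleftrightarrow> (\<exists>ajs. g = Add ajs)"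

section \<open>Circuits with binary multiplications\<close>

locale binary_circuit =
  fixes C :: "('v, 'k::field) circuit"
  assumes wf: "wf_circuit C"
    and binary: "binary_mults C"
begin

abbreviation "gs \<equiv> gates C"
abbreviation "deg \<equiv> gate_degree gs"
abbreviation "val \<equiv> gate_poly gs"

lemma arg_less:
  assumes "i < length gs" "j \<in> set (gate_args (gs ! i))"
  shows "j < i"
  using wf assms by (auto simp: wf_circuit_def)

lemma args_nonempty:
  assumes "i < length gs" "\<not> is_input (gs ! i)"
  shows "gate_args (gs ! i) \<noteq> []"
  using wf assms by (auto simp: wf_circuit_def)

lemma add_arg_less:
  assumes "i < length gs" "gs ! i = Add ajs" "(a, j) \<in> set ajs"
  shows "j < i"
  using arg_less[of i j] assms by force

lemma deg_add_arg:
  assumes "i < length gs" "gs ! i = Add ajs" "(a, j) \<in> set ajs"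
  shows "deg j \<le> deg i"
proof -
  have "deg j \<in> set (map (\<lambda>(a, j). if j < i then deg j else 0) ajs)"
    using add_arg_less[OF assms] assms(3) by force
  then show ?thesis
    by (subst (2) gate_degree.simps) (simp add: assms(2))
qed

lemma mult_args:
  assumes "i < length gs" "is_mult (gs ! i)"
  obtains j k where "gs ! i = Mult [j, k]" "j < i" "k < i"
proof -
  obtain js where js: "gs ! i = Mult js" using assms by (auto simp: is_mult_def)
  with assms(1) have "Mult js \<in> set gs" by (metis nth_mem)
  with binary have "length js = 2" by (auto simp: binary_mults_def)
  then obtain j k where "js = [j, k]" by (auto simp: length_Suc_conv numeral_2_eq_2)
  with js that arg_less[OF assms(1)] show ?thesis by simp
qed

lemma deg_pos: "i < length gs \<Longrightarrow> 1 \<le> deg i"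
proof (induction i rule: less_induct)
  case (less i)
  show ?case
  proof (cases "gs ! i")
    case (Input x)
    then show ?thesis by (subst gate_degree.simps) simp
  next
    case (Mult js)
    with less.prems obtain j k where "gs ! i = Mult [j, k]" "j < i" "k < i"
      by (metis is_mult_def mult_args)
    with less.IH[of j] less.prems show ?thesis by (subst gate_degree.simps) simp
  next
    case (Add ajs)
    with args_nonempty[OF less.prems] obtain a j where "(a, j) \<in> set ajs"
      by (cases ajs) (auto simp: is_input_def)
    with deg_add_arg[OF less.prems Add] add_arg_less[OF less.prems Add] less.IH[of j] less.prems
    show ?thesis by fastforce
  qed
qed

section \<open>Heavy and light factors of a multiplication gate\<close>

definition heavy :: "nat \<Rightarrow> nat" where
  "heavy i = (let js = gate_args (gs ! i) in if deg (js ! 1) \<le> deg (js ! 0) then js ! 0 else js ! 1)"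

definition light :: "nat \<Rightarrow> nat" where
  "light i = (let js = gate_args (gs ! i) in if deg (js ! 1) \<le> deg (js ! 0) then js ! 1 else js ! 0)"

lemma mult_gate:
  assumes "i < length gs" "is_mult (gs ! i)"
  shows "heavy i < i" "light i < i" "deg (light i) \<le> deg (heavy i)"
    "deg i = deg (heavy i) + deg (light i)" "val i = val (heavy i) * val (light i)"
proof -
  obtain j k where jk: "gs ! i = Mult [j, k]" "j < i" "k < i"
    using mult_args[OF assms] .
  then have "deg i = deg j + deg k" "val i = val j * val k"
    by (subst gate_degree.simps gate_poly.simps, simp)+
  with jk show "heavy i < i" "light i < i" "deg (light i) \<le> deg (heavy i)"
    "deg i = deg (heavy i) + deg (light i)" "val i = val (heavy i) * val (light i)"
    by (simp_all add: heavy_def light_def Let_def mult.commute)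
qed

text \<open>The degree bound keeps \<open>h\<close> inside the same copy of the circuit as
  \<open>i\<close>; that \<open>h\<close> is no addition later saves one level.\<close>

lemma add_coeff_nonzero:
  assumes "i < length gs" "add_coeff gs i h \<noteq> 0"
  shows "h \<le> i \<and> \<not> is_add (gs ! h) \<and> deg h \<le> deg i"
  using assms
proof (induction i rule: less_induct)
  case (less i)
  show ?case
  proof (cases "gs ! i")
    case (Add ajs)
    have "\<exists>(a, j)\<in>set ajs. add_coeff gs j h \<noteq> 0"
    proof (rule ccontr)
      assume "\<not> ?thesis"
      then have "(\<Sum>(a, j)\<leftarrow>ajs. if j < i then a * add_coeff gs j h else 0) = 0"
        by (induction ajs) (auto split: if_splits)
      with less.prems(2) Add show False by (subst (asm) add_coeff.simps) simp
    qed
    then obtain a j where "(a, j) \<in> set ajs" "add_coeff gs j h \<noteq> 0" by blast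
    with add_arg_less[OF less.prems(1) Add] deg_add_arg[OF less.prems(1) Add]
      less.IH[of j] less.prems(1)
    show ?thesis by fastforce
  qed (use less.prems in \<open>subst (asm) add_coeff.simps, auto simp: is_add_def split: if_splits\<close>)+
qed

lemma val_add_coeff:
  assumes "i < length gs"
  shows "val i = (\<Sum>h<length gs. val h * poly_const (add_coeff gs i h))"
  using assms
proof (induction i rule: less_induct)
  case (less i)
  have nonadd: ?case if "\<not> is_add (gs ! i)"
  proof -
    have "add_coeff gs i h = (if h = i then 1 else 0)" for h
      using that by (subst add_coeff.simps) (auto simp: is_add_def split: gate.split)
    then have "(\<Sum>h<length gs. val h * poly_const (add_coeff gs i h))
        = (\<Sum>h<length gs. if h = i then val h else 0)"
      by (intro sum.cong) auto
    with less.prems show ?thesis by simp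
  qed
  show ?case
  proof (cases "is_add (gs ! i)")
    case True
    then obtain ajs where Add: "gs ! i = Add ajs" by (auto simp: is_add_def)
    \<comment> \<open>Stated for lists with entries from \<open>ajs\<close>, so that induction on
      the list keeps the fact that all arguments precede \<open>i\<close>.\<close>
    have "set ajs' \<subseteq> set ajs \<Longrightarrow>
        (\<Sum>(a, j)\<leftarrow>ajs'. if j < i then poly_const a * val j else 0)
      = (\<Sum>h<length gs. val h *
           poly_const (\<Sum>(a, j)\<leftarrow>ajs'. if j < i then a * add_coeff gs j h else 0))" for ajs'
    proof (induction ajs')
      case (Cons aj ajs')
      obtain a j where aj: "aj = (a, j)" by fastforce
      with Cons.prems add_arg_less[OF less.prems Add] have j: "j < i" by auto
      then have "poly_const a * val j = (\<Sum>h<length gs. val h * poly_const (a * add_coeff gs j h))"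
        using less.IH[of j] less.prems
        by (simp add: poly_const_mult sum_distrib_left mult_ac)
      then show ?case
        using Cons j by (simp add: aj poly_const_add distrib_left sum.distrib)
    qed simp
    from this[OF order_refl] show ?thesis
      by (subst gate_poly.simps, subst add_coeff.simps) (simp add: Add)
  qed (rule nonadd)
qed

text \<open>Both arguments of gate \<open>i\<close> come before it, so each contributes at most
  \<open>2 ^ (i - 1)\<close> in absolute value, and a sign does not change this.\<close>

lemma add_coeff_ordinary:
  assumes "ordinary_adds C" "i < length gs"
  shows "\<exists>z::int. add_coeff gs i h = of_int z \<and> \<bar>z\<bar> \<le> 2 ^ i"
  using assms(2)
proof (induction i rule: less_induct)
  case (less i)
  show ?case
  proof (cases "is_add (gs ! i)")
    case False
    then have "add_coeff gs i h = of_int (if h = i then 1 else 0)"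
      by (subst add_coeff.simps) (auto simp: is_add_def split: gate.split)
    then show ?thesis by (intro exI[of _ "if h = i then 1 else 0"]) simp
  next
    case True
    then obtain ajs where Add: "gs ! i = Add ajs" by (auto simp: is_add_def)
    with less.prems have "Add ajs \<in> set gs" by (metis nth_mem)
    with assms(1) have "map fst ajs = [1, 1] \<or> map fst ajs = [1, -1]"
      by (auto simp: ordinary_adds_def)
    then obtain \<sigma> :: int and j k where ajs: "ajs = [(1, j), (of_int \<sigma>, k)]" and \<sigma>: "\<bar>\<sigma>\<bar> = 1"
    proof
      assume "map fst ajs = [1, 1]"
      then obtain j k where "ajs = [(1, j), (of_int 1, k)]" by (auto simp: map_eq_Cons_conv)
      then show ?thesis using that[of j 1 k] by simp
    next
      assume "map fst ajs = [1, -1]"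
      then obtain j k where "ajs = [(1, j), (of_int (-1), k)]" by (auto simp: map_eq_Cons_conv)
      then show ?thesis using that[of j "-1" k] by simp
    qed
    have less_i: "j < i" "k < i"
      using add_arg_less[OF less.prems Add] ajs by auto
    obtain y z :: int where yz: "add_coeff gs j h = of_int y" "\<bar>y\<bar> \<le> 2 ^ j"
      "add_coeff gs k h = of_int z" "\<bar>z\<bar> \<le> 2 ^ k"
      using less.IH[of j] less.IH[of k] less_i less.prems by fastforce
    have "add_coeff gs i h = of_int (y + \<sigma> * z)"
      using less_i yz by (subst add_coeff.simps) (simp add: Add ajs)
    moreover have "\<bar>y + \<sigma> * z\<bar> \<le> 2 ^ i"
    proof -
      obtain m where m: "i = Suc m" using less_i by (cases i) auto
      have "\<bar>y + \<sigma> * z\<bar> \<le> \<bar>y\<bar> + \<bar>z\<bar>"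
        using abs_triangle_ineq[of y "\<sigma> * z"] \<sigma> by (simp add: abs_mult)
      also have "\<dots> \<le> 2 ^ m + 2 ^ m"
        using less_i m
        by (intro add_mono order_trans[OF yz(2)] order_trans[OF yz(4)] power_increasing) auto
      finally show ?thesis by (simp add: m)
    qed
    ultimately show ?thesis by blast
  qed
qed

section \<open>The branching program\<close>

text \<open>
  A context is a stack of multiplication gates, innermost first: the context \<open>g # c\<close> is the private
  copy of the part of the circuit of degree at most \<open>deg (light g)\<close> which serves to multiply by
  \<open>val (light g)\<close> behind the vertex of \<open>heavy g\<close> in the context
  \<open>c\<close>. The vertices are the lists \<open>g # c\<close> with \<open>g\<close> an input or addition gate; the list \<open>[]\<close> is the source. A multiplication gate
  has no vertex of its own: it is represented by the end of the copy that belongs to it.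
\<close>

function gate_vertex :: "nat list \<Rightarrow> nat \<Rightarrow> nat list" where
  "gate_vertex c g = (if g < length gs \<and> is_mult (gs ! g) then gate_vertex (g # c) (light g) else g # c)"
  by auto
termination
  by (relation "measure snd") (auto simp: mult_gate)

declare gate_vertex.simps [simp del]

lemma gate_vertex_mult:
  "g < length gs \<Longrightarrow> is_mult (gs ! g) \<Longrightarrow> gate_vertex c g = gate_vertex (g # c) (light g)"
  by (subst gate_vertex.simps) simp

lemma gate_vertex_leaf: "\<not> is_mult (gs ! g) \<Longrightarrow> gate_vertex c g = g # c"
  by (subst gate_vertex.simps) simp

text \<open>This vertex acts as the source of the private copy: every input gate of the copy is
  attached to it.\<close>

primrec context_source :: "nat list \<Rightarrow> nat list" where
  "context_source [] = []"
| "context_source (g # c) = gate_vertex c (heavy g)"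

primrec context_value :: "nat list \<Rightarrow> ('v, 'k) mpoly" where
  "context_value [] = 1"
| "context_value (g # c) = context_value c * val (heavy g)"

text \<open>The summand is the depth allowance for the heavy factor in the worst case, that of an
  addition gate.\<close>

primrec context_level :: "nat list \<Rightarrow> nat" where
  "context_level [] = 0"
| "context_level (g # c) = context_level c + (3 * deg (heavy g) - 1)"

primrec context_degree :: "nat list \<Rightarrow> nat" where
  "context_degree [] = formal_degree C"
| "context_degree (g # c) = deg (light g)"

text \<open>Since \<open>2 * deg (light g) \<le> deg g\<close>, each further entry at least halves
  \<open>context_degree\<close>.\<close>

primrec valid_context :: "nat list \<Rightarrow> bool" where
  "valid_context [] = True"
| "valid_context (g # c) = (valid_context c \<and> g < length gs \<and> is_mult (gs ! g) \<and> deg g \<le> context_degree c)"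

definition leaf_at :: "nat list \<Rightarrow> nat \<Rightarrow> bool" where
  "leaf_at c g \<longleftrightarrow> valid_context c \<and> g < length gs \<and> \<not> is_mult (gs ! g) \<and> deg g \<le> context_degree c"

definition vertex_set :: "nat list set" where
  "vertex_set = insert [] {g # c | g c. leaf_at c g}"

primrec potential :: "nat list \<Rightarrow> ('v, 'k) mpoly" where
  "potential [] = 1"
| "potential (g # c) = context_value c * val g"

primrec level :: "nat list \<Rightarrow> nat" where
  "level [] = 0"
| "level (g # c) = context_level c + (3 * deg g - (if is_add (gs ! g) then 1 else 2))"

text \<open>Gates with coefficient 0 are left out because their degree may be too large for them to
  have a vertex in this copy.\<close>

definition arc_tails :: "nat list \<Rightarrow> nat \<Rightarrow> nat list set" where
  "arc_tails c g = (if is_add (gs ! g)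
     then gate_vertex c ` {h. h < length gs \<and> add_coeff gs g h \<noteq> 0} else {context_source c})"

definition arc_set :: "nat list rel" where
  "arc_set = {(u, g # c) | u g c. leaf_at c g \<and> u \<in> arc_tails c g}"

text \<open>An arc knows only its two ends, so the gate represented by the tail is recovered by
  inverting \<open>gate_vertex\<close> in the context of the head.\<close>

fun arc_weight :: "nat list \<times> nat list \<Rightarrow> ('v, 'k) mpoly" where
  "arc_weight (u, v) = (case gs ! hd v of
      Input x \<Rightarrow> input_poly x
    | _ \<Rightarrow> poly_const (add_coeff gs (hd v) (inv (gate_vertex (tl v)) u)))"

section \<open>Position, potential and level of the vertex representing a gate\<close>

lemma gate_vertex_suffix: "\<exists>l. gate_vertex c g = l @ g # c"
proof (induction c g rule: gate_vertex.induct)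
  case (1 c g)
  show ?case
  proof (cases "g < length gs \<and> is_mult (gs ! g)")
    case True
    with 1 obtain l where "gate_vertex (g # c) (light g) = l @ light g # g # c" by blast
    with True show ?thesis by (intro exI[of _ "l @ [light g]"]) (simp add: gate_vertex_mult)
  qed (auto simp: gate_vertex.simps[of c g])
qed

text \<open>The entry just in front of the suffix \<open>c\<close> is the gate itself.\<close>

lemma inj_gate_vertex: "inj (gate_vertex c)"
proof
  fix g h assume eq: "gate_vertex c g = gate_vertex c h"
  obtain l l' where "gate_vertex c g = l @ g # c" "gate_vertex c h = l' @ h # c"
    using gate_vertex_suffix by metis
  with eq have "(l @ [g]) @ c = (l' @ [h]) @ c" by simp
  then show "g = h" unfolding append_same_eq by simp
qed

lemma gate_vertex_nonempty: "gate_vertex c g \<noteq> []"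
  using gate_vertex_suffix[of c g] by auto

text \<open>Entering the copy for \<open>g\<close> multiplies the context value by the heavy factor,
  and its end supplies the light one.\<close>

lemma potential_gate_vertex: "g < length gs \<Longrightarrow> potential (gate_vertex c g) = context_value c * val g"
proof (induction c g rule: gate_vertex.induct)
  case (1 c g)
  show ?case
  proof (cases "is_mult (gs ! g)")
    case True
    note m = mult_gate[OF 1(2) True]
    from 1 True m(2) have "potential (gate_vertex (g # c) (light g)) = context_value (g # c) * val (light g)" by simp
    with 1 True show ?thesis by (simp add: gate_vertex_mult m(5) mult_ac)
  qed (simp add: gate_vertex_leaf)
qed

lemma potential_context_source: "valid_context c \<Longrightarrow> potential (context_source c) = context_value c"
proof (cases c)
  case (Cons g c')
  assume "valid_context c"
  with Cons mult_gate(1)[of g] show ?thesis by (simp add: potential_gate_vertex)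
qed simp

text \<open>For a product, the allowances of the two factors add up to
  \<open>(3 * a - 1) + (3 * b - 1) = 3 * (a + b) - 2\<close>, even if both factors are
  additions.\<close>

lemma level_gate_vertex:
  "g < length gs \<Longrightarrow> level (gate_vertex c g) \<le> context_level c + (3 * deg g - (if is_add (gs ! g) then 1 else 2))"
proof (induction c g rule: gate_vertex.induct)
  case (1 c g)
  show ?case
  proof (cases "is_mult (gs ! g)")
    case True
    note m = mult_gate[OF 1(2) True]
    have "level (gate_vertex (g # c) (light g)) \<le> context_level (g # c) + (3 * deg (light g) - 1)"
      using 1(1)[OF conjI[OF 1(2) True]] m(2) 1(2) by (simp split: if_splits)
    \<comment> \<open>Positive degrees keep the subtractions on \<open>nat\<close> from being
      truncated.\<close>
    moreover have "1 \<le> deg (heavy g)" "1 \<le> deg (light g)"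
      using deg_pos m(1,2) 1(2) by auto
    moreover have "\<not> is_add (gs ! g)"
      using True by (auto simp: is_add_def is_mult_def)
    ultimately show ?thesis
      using 1 True m(4) by (simp add: gate_vertex_mult)
  qed (simp add: gate_vertex_leaf)
qed

lemma level_context_source: "valid_context c \<Longrightarrow> level (context_source c) \<le> context_level c"
proof (cases c)
  case (Cons g c')
  assume "valid_context c"
  with Cons mult_gate(1)[of g] have "heavy g < length gs" by auto
  with level_gate_vertex[of "heavy g" c'] show ?thesis by (simp add: Cons split: if_splits)
qed simp

lemma gate_vertex_in_vertex_set:
  "valid_context c \<Longrightarrow> g < length gs \<Longrightarrow> deg g \<le> context_degree c \<Longrightarrow> gate_vertex c g \<in> vertex_set"
proof (induction c g rule: gate_vertex.induct)
  case (1 c g)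
  show ?case
  proof (cases "is_mult (gs ! g)")
    case True
    with 1 mult_gate(2)[OF 1(3) True] show ?thesis by (simp add: gate_vertex_mult)
  next
    case False
    with 1 show ?thesis by (simp add: gate_vertex_leaf vertex_set_def leaf_at_def)
  qed
qed

lemma context_source_in_vertex_set: "valid_context c \<Longrightarrow> context_source c \<in> vertex_set"
proof (cases c)
  case (Cons g c')
  assume "valid_context c"
  with Cons mult_gate[of g] show ?thesis by (auto intro!: gate_vertex_in_vertex_set)
qed (simp add: vertex_set_def)

section \<open>Arcs and the recurrence for the potential\<close>

lemma leaf_at_add_coeff:
  assumes "leaf_at c g" "add_coeff gs g h \<noteq> 0"
  shows "h < length gs" "deg h \<le> deg g" "\<not> is_add (gs ! h)"
  using add_coeff_nonzero[of g h] assms by (auto simp: leaf_at_def)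

lemma arc_set_subset: "arc_set \<subseteq> vertex_set \<times> vertex_set"
proof clarify
  fix u v assume "(u, v) \<in> arc_set"
  then obtain g c where v: "v = g # c" "leaf_at c g" "u \<in> arc_tails c g"
    by (auto simp: arc_set_def)
  have "u \<in> vertex_set"
  proof (cases "is_add (gs ! g)")
    case True
    with v obtain h where "u = gate_vertex c h" "add_coeff gs g h \<noteq> 0" by (auto simp: arc_tails_def)
    with leaf_at_add_coeff[of c g h] v show ?thesis by (auto simp: leaf_at_def intro!: gate_vertex_in_vertex_set)
  next
    case False
    with v show ?thesis by (auto simp: leaf_at_def arc_tails_def intro!: context_source_in_vertex_set)
  qed
  with v show "u \<in> vertex_set \<and> v \<in> vertex_set" by (auto simp: vertex_set_def)
qed

text \<open>The tail of an arc into an addition represents a non-addition of no larger degree, so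
  \<open>3 * deg h - 2 < 3 * deg g - 1\<close>. An input lies above the source of its copy because
  its degree is positive.\<close>

lemma arc_set_level:
  assumes "(u, v) \<in> arc_set"
  shows "level u < level v"
proof -
  obtain g c where v: "v = g # c" "leaf_at c g" "u \<in> arc_tails c g"
    using assms by (auto simp: arc_set_def)
  then have g: "g < length gs" "valid_context c" "1 \<le> deg g" using deg_pos by (auto simp: leaf_at_def)
  show ?thesis
  proof (cases "is_add (gs ! g)")
    case True
    with v obtain h where h: "u = gate_vertex c h" "add_coeff gs g h \<noteq> 0" by (auto simp: arc_tails_def)
    note h' = leaf_at_add_coeff[OF v(2) h(2)]
    with level_gate_vertex[of h c] h g True deg_pos[OF h'(1)] show ?thesis by (simp add: v)
  next
    case False
    with v level_context_source[OF g(2)] g show ?thesis by (simp add: arc_tails_def)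
  qed
qed

text \<open>For additions this is \<open>val_add_coeff\<close> times the context value, reindexed
  along the injective \<open>gate_vertex c\<close>.\<close>

lemma potential_step:
  assumes "leaf_at c g"
  shows "potential (g # c) = (\<Sum>u\<in>arc_tails c g. potential u * arc_weight (u, g # c))"
proof (cases "gs ! g")
  case (Input x)
  then have "arc_tails c g = {context_source c}" by (simp add: arc_tails_def is_add_def)
  moreover have "val g = input_poly x" by (subst gate_poly.simps) (simp add: Input)
  ultimately show ?thesis using assms by (simp add: Input potential_context_source leaf_at_def)
next
  case (Mult js)
  with assms show ?thesis by (simp add: leaf_at_def is_mult_def)
next
  case (Add ajs)
  have "val g = (\<Sum>h<length gs. val h * poly_const (add_coeff gs g h))"
    using assms by (intro val_add_coeff) (simp add: leaf_at_def)
  also have "\<dots> = (\<Sum>h | h < length gs \<and> add_coeff gs g h \<noteq> 0. val h * poly_const (add_coeff gs g h))"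
    by (rule sum.mono_neutral_right) auto
  finally have "context_value c * val g
      = (\<Sum>h | h < length gs \<and> add_coeff gs g h \<noteq> 0.
           potential (gate_vertex c h) * poly_const (add_coeff gs g h))"
    by (simp add: sum_distrib_left potential_gate_vertex mult_ac)
  with Add show ?thesis
    by (simp add: arc_tails_def is_add_def sum.reindex inj_on_subset[OF inj_gate_vertex]
        inv_f_f[OF inj_gate_vertex])
qed

text \<open>
  The argument \<open>n\<close> is fuel: the formal degree is enough of it, as contexts are never deeper.
\<close>

primrec vertices_above :: "nat \<Rightarrow> nat list \<Rightarrow> nat list set" where
  "vertices_above 0 c = {}"
| "vertices_above (Suc n) c = (\<Union>g\<in>{g. g < length gs \<and> deg g \<le> context_degree c}.
     if is_mult (gs ! g) then vertices_above n (g # c) else {g # c})"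

section \<open>Counting the vertices\<close>

lemma finite_vertices_above: "finite (vertices_above n c)"
  by (induction n arbitrary: c) auto

lemma length_gs_pos: "1 \<le> length gs"
  using wf by (auto simp: wf_circuit_def)

text \<open>With \<open>t\<close> gates and degree cap \<open>D\<close>, each gate contributes at
  most \<open>t powr log 2 D\<close> vertices, and one more factor \<open>t\<close> turns
  \<open>log 2 D\<close> into \<open>log 2 (2 * D)\<close>.\<close>

lemma card_vertices_above:
  assumes "1 \<le> context_degree c"
  shows "real (card (vertices_above n c)) \<le> real (length gs) powr log 2 (2 * real (context_degree c))"
  using assms
proof (induction n arbitrary: c)
  case (Suc n)
  let ?t = "real (length gs)" and ?D = "real (context_degree c)"
  let ?I = "{g. g < length gs \<and> deg g \<le> context_degree c}"
  let ?A = "\<lambda>g. if is_mult (gs ! g) then vertices_above n (g # c) else {g # c}"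
  have t: "1 \<le> ?t" using length_gs_pos by simp
  have part: "real (card (?A g)) \<le> ?t powr log 2 ?D" if "g \<in> ?I" for g
  proof (cases "is_mult (gs ! g)")
    case True
    from that have g: "g < length gs" "deg g \<le> context_degree c" by auto
    note m = mult_gate[OF g(1) True]
    have pos: "1 \<le> deg (light g)" using deg_pos m(2) g(1) by simp
    have "real (card (vertices_above n (g # c))) \<le> ?t powr log 2 (2 * real (deg (light g)))"
      using Suc.IH[of "g # c"] pos by simp
    also have "\<dots> \<le> ?t powr log 2 ?D"
    proof (rule powr_mono[OF _ t])
      \<comment> \<open>The light factor has at most half the degree of \<open>g\<close>; this
        cancels the 2 in the induction hypothesis.\<close>
      have "2 * deg (light g) \<le> context_degree c" using m(3,4) g(2) by simp
      then show "log 2 (2 * real (deg (light g))) \<le> log 2 ?D" using pos by simp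
    qed
    finally show ?thesis using True by simp
  next
    case False
    have "1 \<le> ?t powr log 2 ?D" using t Suc.prems by (intro ge_one_powr_ge_zero) auto
    with False show ?thesis by simp
  qed
  have "card ?I \<le> card {..<length gs}" by (rule card_mono) auto
  then have I: "real (card ?I) \<le> ?t" by simp
  have "real (card (vertices_above (Suc n) c)) \<le> (\<Sum>g\<in>?I. real (card (?A g)))"
    unfolding vertices_above.simps by (subst of_nat_sum[symmetric], rule of_nat_mono, rule card_UN_le) simp
  also have "\<dots> \<le> (\<Sum>g\<in>?I. ?t powr log 2 ?D)" by (rule sum_mono) (rule part)
  also have "\<dots> \<le> ?t * ?t powr log 2 ?D" using I by (simp add: mult_right_mono)
  also have "\<dots> = ?t powr (1 + log 2 ?D)" using t by (simp add: powr_add)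
  also have "1 + log 2 ?D = log 2 (2 * ?D)" using Suc.prems by (simp add: log_mult)
  finally show ?case .
qed simp

text \<open>Pushing \<open>g\<close> lowers the degree cap by at least \<open>deg (heavy g)\<close>,
  which is positive.\<close>

lemma context_degree_plus_length: "valid_context c \<Longrightarrow> context_degree c + length c \<le> formal_degree C"
proof (induction c)
  case (Cons g c)
  with mult_gate[of g] deg_pos[of "heavy g"] show ?case by simp
qed simp

text \<open>Each entry of the context can be traded for one unit of fuel.\<close>

lemma vertices_above_subset: "valid_context c \<Longrightarrow> vertices_above n c \<subseteq> vertices_above (n + length c) []"
proof (induction c arbitrary: n)
  case (Cons g c)
  then have "vertices_above n (g # c) \<subseteq> vertices_above (Suc n) c" by (auto intro!: exI[of _ g])
  also have "\<dots> \<subseteq> vertices_above (Suc n + length c) []"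
    using Cons.prems by (intro Cons.IH) simp
  finally show ?case by simp
qed simp

lemma vertex_set_subset: "vertex_set \<subseteq> insert [] (vertices_above (formal_degree C) [])"
proof -
  have "g # c \<in> vertices_above (formal_degree C) []" if "leaf_at c g" for g c
  proof -
    have "length c < formal_degree C" "valid_context c"
      using that context_degree_plus_length[of c] deg_pos[of g] by (auto simp: leaf_at_def)
    \<comment> \<open>The inequality is strict because the leaf has positive degree, so a unit of
      fuel remains for the leaf itself.\<close>
    then obtain n where "formal_degree C = Suc n + length c"
      by (metis add.commute add_Suc_right less_iff_Suc_add)
    moreover have "g # c \<in> vertices_above (Suc n) c" using that by (auto simp: leaf_at_def)
    ultimately show ?thesis using vertices_above_subset[OF \<open>valid_context c\<close>, of "Suc n"] by auto
  qed
  then show ?thesis by (auto simp: vertex_set_def)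
qed

lemma out_gate_less: "out_gate C < length gs"
  using wf by (simp add: wf_circuit_def)

lemma finite_vertex_set: "finite vertex_set"
  using vertex_set_subset finite_vertices_above by (auto intro: finite_subset)

text \<open>The additional 1 accounts for the source \<open>[]\<close>.\<close>

lemma card_vertex_set: "real (card vertex_set) \<le> real (length gs) powr log 2 (2 * real (formal_degree C)) + 1"
proof -
  have "card vertex_set \<le> card (vertices_above (formal_degree C) []) + 1"
    using card_mono[OF _ vertex_set_subset] finite_vertices_above[of "formal_degree C" "[]"]
    by (simp add: card_insert_if split: if_splits)
  moreover have "1 \<le> formal_degree C"
    using deg_pos[OF out_gate_less] by (simp add: formal_degree_def)
  ultimately show ?thesis using card_vertices_above[of "[]" "formal_degree C"] by simp
qed

lemma arc_weight_cases:
  assumes "e \<in> arc_set"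
  shows "(\<exists>x \<in> circuit_inputs C. arc_weight e = input_poly x) \<or>
    (\<exists>c. arc_weight e = poly_const c \<and>
       (ordinary_adds C \<longrightarrow> (\<exists>z::int. c = of_int z \<and> \<bar>z\<bar> \<le> 2 ^ length gs)))"
proof -
  obtain u g c where e: "e = (u, g # c)" "g < length gs" using assms by (auto simp: arc_set_def leaf_at_def)
  show ?thesis
  proof (cases "gs ! g")
    case (Input x)
    with e show ?thesis by (auto simp: circuit_inputs_def intro!: bexI[of _ x]) (metis nth_mem)
  next
    case (Mult js)
    with assms e show ?thesis by (auto simp: arc_set_def leaf_at_def is_mult_def)
  next
    case (Add ajs)
    let ?a = "add_coeff gs g (inv (gate_vertex c) u)"
    have "\<exists>z::int. ?a = of_int z \<and> \<bar>z\<bar> \<le> 2 ^ length gs" if o: "ordinary_adds C"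
    proof -
      obtain z :: int where z: "?a = of_int z" "\<bar>z\<bar> \<le> 2 ^ g"
        using add_coeff_ordinary[OF o e(2)] by blast
      moreover have "(2::int) ^ g \<le> 2 ^ length gs" using e(2) by simp
      ultimately show ?thesis by (meson order_trans)
    qed
    with Add e show ?thesis by auto
  qed
qed

end

theorem theorem2:
  fixes C :: "('v, 'k::field) circuit" and t d :: nat
  assumes "wf_circuit C"
    and "circuit_size C = t"
    and "formal_degree C = d"
    and "binary_mults C"
  shows "\<exists>G :: (nat, ('v, 'k) mpoly) abp.
           wf_abp G \<and>
           abp_value G = circuit_poly C \<and>
           real (abp_size G) \<le> real t powr log 2 (2 * real d) + 1 \<and>
           abp_depth G \<le> 3 * d - 1 \<and>
           (\<forall>e \<in> parcs (graph G).
              (\<exists>x \<in> circuit_inputs C. weight G e = input_poly x) \<or>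
              (\<exists>c. weight G e = poly_const c \<and>
                 (ordinary_adds C \<longrightarrow> (\<exists>z::int. c = of_int z \<and> \<bar>z\<bar> \<le> 2 ^ t))))"
proof -
  interpret binary_circuit C
    using assms by unfold_locales
  let ?z = "gate_vertex [] (out_gate C)"
  have z: "?z \<in> vertex_set"
    using gate_vertex_in_vertex_set[of "[]"] out_gate_less by (simp add: formal_degree_def)
  have "\<exists>G :: (nat, ('v, 'k) mpoly) abp. wf_abp G \<and> abp_value G = potential ?z \<and>
      abp_size G = card vertex_set \<and>
      abp_depth G \<le> level ?z \<and> (\<forall>e \<in> parcs (graph G). \<exists>e' \<in> arc_set. weight G e = arc_weight e')"
  \<comment> \<open>In the empty context the value is 1 and the level 0, so the potential at
    \<open>?z\<close> is the output polynomial and its level is at most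
    \<open>3 * d - 1\<close>.\<close>
  proof (rule abp_of_potential[where s = "[]"])
    fix v assume "v \<in> vertex_set" "v \<noteq> []"
    then obtain g c where v: "v = g # c" "leaf_at c g" by (auto simp: vertex_set_def)
    then have "{u. (u, v) \<in> arc_set} = arc_tails c g" by (auto simp: arc_set_def)
    with v potential_step show "potential v = (\<Sum>u | (u, v) \<in> arc_set. potential u * arc_weight (u, v))" by simp
  qed (use finite_vertex_set arc_set_subset arc_set_level z
        gate_vertex_nonempty in \<open>auto simp: arc_set_def vertex_set_def\<close>)
  then obtain G :: "(nat, ('v, 'k) mpoly) abp" where G: "wf_abp G" "abp_value G = potential ?z"
    "abp_size G = card vertex_set" "abp_depth G \<le> level ?z"
    "\<And>e. e \<in> parcs (graph G) \<Longrightarrow> \<exists>e' \<in> arc_set. weight G e = arc_weight e'"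
    by auto
  have t: "length gs = t" using assms(2) by (simp add: circuit_size_def)
  have "abp_value G = circuit_poly C"
    by (simp add: G(2) potential_gate_vertex out_gate_less circuit_poly_def)
  moreover have "abp_depth G \<le> 3 * d - 1"
    using G(4) level_gate_vertex[OF out_gate_less, of "[]"] assms(3)
    by (simp add: formal_degree_def split: if_splits)
  moreover have "real (abp_size G) \<le> real t powr log 2 (2 * real d) + 1"
    using card_vertex_set assms(3) by (simp add: G(3) t)
  moreover have labels: "(\<exists>x \<in> circuit_inputs C. weight G e = input_poly x) \<or>
      (\<exists>c. weight G e = poly_const c \<and>
         (ordinary_adds C \<longrightarrow> (\<exists>z::int. c = of_int z \<and> \<bar>z\<bar> \<le> 2 ^ t)))"
    if "e \<in> parcs (graph G)" for e
  proof -
    obtain e' where "e' \<in> arc_set" "weight G e = arc_weight e'" using G(5) \<open>e \<in> parcs (graph G)\<close> by blast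
    with arc_weight_cases[of e'] show ?thesis by (simp only: t)
  qed
  ultimately show ?thesis
    using G(1) labels by (intro exI[of _ G]) simp
qed

end
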